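(* Let $d\in\{2,3\}$. For two states with primitive variables $(p_-,\mathbf{u}_-)$ and $(p_+,\mathbf{u}_+)$, where $p_\pm>0$ and $\mathbf{u}_\pm=(u_{1,\pm},\dots,u_{d,\pm})\in\mathbb{R}^d$, and for each space direction $k\in\{1,\dots,d\}$, define the two-point numerical flux $\tilde{\mathbf{F}}_k=(\tilde{\mathbf{F}}_k^{(1)},\dots,\tilde{\mathbf{F}}_k^{(d)},\tilde{\mathbf{F}}_k^{(d+1)})^T\in\mathbb{R}^{d+1}$ by $$\tilde{\mathbf{F}}_k^{(i)} = 2\left(p_-\sqrt{p_+}+p_+\sqrt{p_-}\right)\{\!\{u_i p^{-1/4}\}\!\}\,\{\!\{u_k p^{-1/4}\}\!\}+\{\!\{p\}\!\}\,\delta_{ik},\qquad i=1,\dots,d,$$ $$\tilde{\mathbf{F}}_k^{(d+1)} = 2\left(p_-\sqrt{p_+}+p_+\sqrt{p_-}\right)\{\!\{p^{-1/4}\sqrt{1+|\mathbf{u}|^2}\}\!\}\,\{\!\{u_k p^{-1/4}\}\!\},$$ where $\{\!\{a\}\!\}=(a_++a_-)/2$ denotes the arithmetic mean of the values of $a$ at the two states. Then these numerical fluxes are symmetric, consistent, and entropy-conservative two-point fluxes for the $d$-dimensional ultra-relativistic Euler equations. That is, for every $k\in\{1,\dots,d\}$: (i) (symmetry) $\tilde{\mathbf{F}}_k$ is unchanged when the two states $(p_-,\mathbf{u}_-)$ and $(p_+,\mathbf{u}_+)$ are exchanged; (ii) (consistency) if $(p_-,\mathbf{u}_-)=(p_+,\mathbf{u}_+)=(p,\mathbf{u})$,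 then $\tilde{\mathbf{F}}_k=\mathbf{F}_k$, the physical flux in direction $k$ at the state $(p,\mathbf{u})$; (iii) (entropy conservation) for all pairs of states, $[\![\mathbf{h}]\!]\cdot\tilde{\mathbf{F}}_k-[\![\psi_k]\!]=0$, where $[\![a]\!]=a_+-a_-$ denotes the jump, $\mathbf{h}$ is the vector of entropy variables, and $\psi_k$ is the flux potential in direction $k$.
   Context: The ultra-relativistic Euler equations in $d\in\{2,3\}$ space dimensions, for the pressure $p>0$ and the spatial part of the dimensionless four-velocity $\mathbf{u}=(u_1,\dots,u_d)\in\mathbb{R}^d$, form the conservative system $\partial_t\mathbf{w}+\sum_{k=1}^d\partial_{x_k}\mathbf{F}_k(\mathbf{w})=0$ with conserved variables $\mathbf{w}=(w_1,\dots,w_{d+1})$, $$w_j=4pu_j\sqrt{1+|\mathbf{u}|^2}\ (j=1,\dots,d),\qquad w_{d+1}=p(3+4|\mathbf{u}|^2),$$ and physical fluxes $\mathbf{F}_k=(\mathbf{F}_k^{(1)},\dots,\mathbf{F}_k^{(d+1)})^T$, $k=1,\dots,d$, $$\mathbf{F}_k^{(i)}=p\,\delta_{ik}+4pu_iu_k\ (i=1,\dots,d),\qquad \mathbf{F}_k^{(d+1)}=4pu_k\sqrt{1+|\mathbf{u}|^2}.$$ Here $|\cdot|$ is the Euclidean norm and $\delta_{ik}$ the Kronecker delta. The entropy is $\eta=p^{3/4}\sqrt{1+|\mathbf{u}|^2}$ with entropy flux $\mathbf{q}=p^{3/4}\mathbf{u}$, with components $q_k=p^{3/4}u_k$. The entropy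 variables are $\mathbf{h}=(h_1,\dots,h_{d+1})^T$ with $h_j=\partial_{w_j}\eta$, explicitly $$h_j=-\frac14\frac{\eta}{p}\frac{u_j}{\sqrt{1+|\mathbf{u}|^2}}=-\frac14 p^{-1/4}u_j\ (j=1,\dots,d),\qquad h_{d+1}=\frac14\frac{\eta}{p}=\frac14p^{-1/4}\sqrt{1+|\mathbf{u}|^2}.$$ The flux potential in direction $k$ is $$\psi_k=\mathbf{h}\cdot\mathbf{F}_k-q_k=-\frac14\,\eta\,\frac{u_k}{\sqrt{1+|\mathbf{u}|^2}}=-\frac14p^{3/4}u_k.$$ For any quantity $a$ depending on the state, $a_\pm$ denotes its value at the state $(p_\pm,\mathbf{u}_\pm)$; the jump is $[\![a]\!]=a_+-a_-$ and the arithmetic mean is $\{\!\{a\}\!\}=(a_++a_-)/2$. For example, $\{\!\{u_ip^{-1/4}\}\!\}=\tfrac12(u_{i,+}p_+^{-1/4}+u_{i,-}p_-^{-1/4})$. *)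

theory Defs
  imports "HOL-Analysis.Analysis"
begin

text \<open>
  A primitive state is a pair \<open>(p, u)\<close>. Vectors of \<open>\<real>\<^sup>d\<^sup>+\<^sup>1\<close>, such as the conserved variables, the
  fluxes and the entropy variables, are elements of \<^typ>\<open>(real ^ 'd) \<times> real\<close>: the first component
  collects the entries \<open>1, \<dots>, d\<close>, the second one is entry \<open>d + 1\<close>. The inner product of this type is
  the Euclidean one of \<open>\<real>\<^sup>d\<^sup>+\<^sup>1\<close>.
\<close>

type_synonym 'd state = "real \<times> (real ^ 'd)"
type_synonym 'd cvec = "(real ^ 'd) \<times> real"

definition states :: "('d::finite) state set" where
  "states = {(p, u). p > 0}"

definition conserved :: "('d::finite) state \<Rightarrow> 'd cvec" where
  "conserved = (\<lambda>(p, u).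
     (\<chi> j. 4 * p * u $ j * sqrt (1 + (norm u)\<^sup>2), p * (3 + 4 * (norm u)\<^sup>2)))"

definition phys_flux :: "'d \<Rightarrow> ('d::finite) state \<Rightarrow> 'd cvec" where
  "phys_flux k = (\<lambda>(p, u).
     (\<chi> i. p * (if i = k then 1 else 0) + 4 * p * u $ i * u $ k,
      4 * p * u $ k * sqrt (1 + (norm u)\<^sup>2)))"

definition entropy :: "('d::finite) state \<Rightarrow> real" where
  "entropy = (\<lambda>(p, u). p powr (3/4) * sqrt (1 + (norm u)\<^sup>2))"

definition entropy_flux :: "'d \<Rightarrow> ('d::finite) state \<Rightarrow> real" where
  "entropy_flux k = (\<lambda>(p, u). p powr (3/4) * u $ k)"

text \<open>
  The entropy as a function of the conserved variables. The map \<^const>\<open>conserved\<close> is injective on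
  \<^const>\<open>states\<close>, with open image.
\<close>

definition entropy_cons :: "('d::finite) cvec \<Rightarrow> real" where
  "entropy_cons w = entropy (inv_into states conserved w)"

text \<open>
  The entropy variables \<open>h\<^sub>j = \<partial>\<eta>/\<partial>w\<^sub>j\<close>: partial derivatives of the entropy with respect to the
  conserved variables. They exist at every state with \<open>p > 0\<close>,
  with the values given in lemma \<open>entropy_vars_explicit\<close> below.
\<close>

definition entropy_vars :: "('d::finite) state \<Rightarrow> 'd cvec" where
  "entropy_vars s =
     (\<chi> j. deriv (\<lambda>t. entropy_cons (conserved s + t *\<^sub>R (axis j 1, 0))) 0,
      deriv (\<lambda>t. entropy_cons (conserved s + t *\<^sub>R (0, 1))) 0)"

definition flux_potential :: "'d \<Rightarrow> ('d::finite) state \<Rightarrow> real" where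
  "flux_potential k s = entropy_vars s \<bullet> phys_flux k s - entropy_flux k s"

text \<open>
  Jump and mean of a state-dependent quantity; the first state argument is the minus state.
\<close>

definition jump :: "(('d::finite) state \<Rightarrow> 'v::real_vector) \<Rightarrow> 'd state \<Rightarrow> 'd state \<Rightarrow> 'v" where
  "jump a sm sp = a sp - a sm"

definition mean :: "(('d::finite) state \<Rightarrow> real) \<Rightarrow> 'd state \<Rightarrow> 'd state \<Rightarrow> real" where
  "mean a sm sp = (a sp + a sm) / 2"

definition num_flux :: "'d \<Rightarrow> ('d::finite) state \<Rightarrow> 'd state \<Rightarrow> 'd cvec" where
  "num_flux k sm sp =
     (let pm = fst sm; pp = fst sp; c = 2 * (pm * sqrt pp + pp * sqrt pm) in
       (\<chi> i. c * mean (\<lambda>(p, u). u $ i * p powr (-1/4)) sm sp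
                * mean (\<lambda>(p, u). u $ k * p powr (-1/4)) sm sp
              + mean fst sm sp * (if i = k then 1 else 0),
        c * mean (\<lambda>(p, u). p powr (-1/4) * sqrt (1 + (norm u)\<^sup>2)) sm sp
          * mean (\<lambda>(p, u). u $ k * p powr (-1/4)) sm sp))"

text \<open>
  The following lemmas show that the partial derivatives in \<^const>\<open>entropy_vars\<close> exist and have the
  expected values. On conserved vectors \<open>(m, E)\<close> with \<open>|m| < E\<close> the pressure is recovered as
  \<open>p = (sqrt (4 E\<^sup>2 - 3 |m|\<^sup>2) - E) / 3\<close>.
\<close>

definition cons_root :: "('d::finite) cvec \<Rightarrow> real" where
  "cons_root w = (sqrt (4 * (snd w)\<^sup>2 - 3 * (fst w \<bullet> fst w)) - snd w) / 3"

lemma conserved_fst: "conserved (p, u) = ((4 * p * sqrt (1 + u \<bullet> u)) *\<^sub>R u, p * (3 + 4 * (u \<bullet> u)))"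
  by (simp add: conserved_def vec_eq_iff power2_norm_eq_inner)

lemma conserved_sq: "fst (conserved (p, u)) \<bullet> fst (conserved (p, u)) = 16 * p\<^sup>2 * (1 + u \<bullet> u) * (u \<bullet> u)"
proof -
  have "(sqrt (1 + u \<bullet> u))\<^sup>2 = 1 + u \<bullet> u" by (simp add: add_nonneg_nonneg)
  moreover have "fst (conserved (p, u)) \<bullet> fst (conserved (p, u)) = 16 * p\<^sup>2 * (sqrt (1 + u \<bullet> u))\<^sup>2 * (u \<bullet> u)"
    unfolding conserved_fst by (simp add: power2_eq_square del: real_sqrt_mult_self)
  ultimately show ?thesis by simp
qed

lemma disc_conserved:
  "4 * (snd (conserved (p, u)))\<^sup>2 - 3 * (fst (conserved (p, u)) \<bullet> fst (conserved (p, u)))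
    = (p * (6 + 4 * (u \<bullet> u)))\<^sup>2"
  unfolding conserved_sq by (simp add: conserved_fst power2_eq_square algebra_simps)

lemma cons_root_conserved: "p > 0 \<Longrightarrow> cons_root (conserved (p, u)) = p"
  unfolding cons_root_def disc_conserved by (simp add: conserved_fst algebra_simps)

lemma inj_on_conserved: "inj_on conserved states"
proof (rule inj_onI, clarsimp simp: states_def)
  fix p q :: real and u v :: "real ^ 'd"
  assume pq: "p > 0" "q > 0" and eq: "conserved (p, u) = conserved (q, v)"
  have qp: "q = p" using cons_root_conserved pq eq by metis
  have e: "u \<bullet> u = v \<bullet> v" using eq pq unfolding conserved_fst qp by simp
  have "1 + v \<bullet> v > 0" by (simp add: add_pos_nonneg)
  then have "u = v" using eq pq unfolding conserved_fst qp e by simp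
  with qp show "p = q \<and> u = v" by simp
qed

lemma entropy_cons_eq:
  assumes "norm (fst w) < snd w"
  shows "entropy_cons w = cons_root w powr (1/4) * sqrt (cons_root w + snd w) / 2"
proof -
  obtain m E where w: "w = (m, E)" by force
  have mE: "m \<bullet> m < E\<^sup>2" "E > 0"
    using assms norm_ge_zero[of m] unfolding w
    by (auto simp: power2_norm_eq_inner[symmetric] intro: power_strict_mono)
      (smt (verit) norm_ge_zero)
  define R where "R = sqrt (4 * E\<^sup>2 - 3 * (m \<bullet> m))"
  have "R > sqrt (E\<^sup>2)" unfolding R_def using mE by (intro real_sqrt_less_mono) simp
  then have RE: "R > E" using mE by simp
  have RR: "R\<^sup>2 = 4 * E\<^sup>2 - 3 * (m \<bullet> m)" unfolding R_def using mE
    by (intro real_sqrt_pow2) (smt (verit) zero_le_power2)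
  define p where "p = (R - E) / 3"
  have p: "p > 0" unfolding p_def using RE by simp
  have pw: "cons_root w = p" unfolding cons_root_def p_def R_def w by simp
  have mm: "m \<bullet> m = (p + E) * (E - 3 * p)"
    using RR unfolding p_def by (simp add: power2_eq_square field_simps)
  define u where "u = (1 / sqrt (4 * p * (p + E))) *\<^sub>R m"
  have uu: "u \<bullet> u = (E - 3 * p) / (4 * p)"
  proof -
    have "u \<bullet> u = (m \<bullet> m) / (4 * p * (p + E))"
      using p mE unfolding u_def by (simp add: real_sqrt_mult[symmetric] flip: power2_eq_square)
    also have "\<dots> = ((p + E) * (E - 3 * p)) / ((p + E) * (4 * p))" unfolding mm by (simp add: mult_ac)
    also have "\<dots> = (E - 3 * p) / (4 * p)" using p mE by (subst mult_divide_mult_cancel_left) auto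
    finally show ?thesis .
  qed
  have g: "1 + u \<bullet> u = (p + E) / (4 * p)" unfolding uu using p by (simp add: field_simps)
  have sq: "sqrt (4 * p * (p + E)) = 4 * p * sqrt ((p + E) / (4 * p))"
  proof -
    have "4 * p * (p + E) = (4 * p)\<^sup>2 * ((p + E) / (4 * p))"
      using p by (simp add: power2_eq_square)
    then have "sqrt (4 * p * (p + E)) = sqrt ((4 * p)\<^sup>2) * sqrt ((p + E) / (4 * p))"
      by (simp only: real_sqrt_mult)
    also have "sqrt ((4 * p)\<^sup>2) = 4 * p" using p by (simp only: real_sqrt_abs)
    finally show ?thesis .
  qed
  have "conserved (p, u) = w"
  proof -
    have "(4 * p * sqrt ((p + E) / (4 * p))) *\<^sub>R u = m"
      unfolding u_def sq using p mE by simp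
    moreover have "p * (3 + 4 * (u \<bullet> u)) = E"
      unfolding uu using p by (simp add: field_simps)
    ultimately show ?thesis unfolding conserved_fst g w by simp
  qed
  moreover have "(p, u) \<in> states" using p by (simp add: states_def)
  ultimately have "inv_into states conserved w = (p, u)"
    using inv_into_f_f[OF inj_on_conserved] by metis
  then have "entropy_cons w = p powr (3/4) * sqrt (1 + u \<bullet> u)"
    by (simp add: entropy_cons_def entropy_def power2_norm_eq_inner)
  also have "\<dots> = p powr (3/4) * (sqrt (p + E) / (2 * sqrt p))"
    unfolding g by (simp add: real_sqrt_divide real_sqrt_mult)
  also have "\<dots> = p powr (1/4) * sqrt (p + E) / 2"
  proof -
    have "p powr (3/4) = p powr (1/4) * sqrt p"
      using p by (simp add: powr_half_sqrt[symmetric] powr_add[symmetric])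
    then show ?thesis using p by simp
  qed
  finally show ?thesis using pw by (simp add: w)
qed

lemma entropy_cons_deriv:
  fixes u a :: "real ^ 'd::finite"
  assumes p: "p > 0"
  shows "((\<lambda>t. entropy_cons (conserved (p, u) + t *\<^sub>R (a, b))) has_real_derivative
           p powr (-1/4) / 4 * (b * sqrt (1 + u \<bullet> u) - u \<bullet> a)) (at 0)"
proof -
  define m E where "m = fst (conserved (p, u))" and "E = snd (conserved (p, u))"
  define s g where "s = u \<bullet> u" and "g = sqrt (1 + s)"
  have s: "s \<ge> 0" unfolding s_def by simp
  have g: "g > 0" "g\<^sup>2 = 1 + s" unfolding g_def using s by auto
  have mu: "m = (4 * p * g) *\<^sub>R u" and E: "E = p * (3 + 4 * s)"
    by (simp_all add: m_def E_def conserved_fst g_def s_def)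
  have mm: "m \<bullet> m = 16 * p\<^sup>2 * (1 + s) * s" 
    unfolding m_def conserved_sq s_def by simp
  have E0: "E > 0" unfolding E using p s by (simp add: add_pos_nonneg)
  have "E\<^sup>2 - m \<bullet> m = p\<^sup>2 * (9 + 8 * s)" unfolding mm E by (simp add: power2_eq_square algebra_simps)
  moreover have "p\<^sup>2 * (9 + 8 * s) > 0" using p s by simp
  ultimately have "m \<bullet> m < E\<^sup>2" by linarith
  then have "norm m < E" using E0 power2_norm_eq_inner power_less_imp_less_base less_imp_le by metis
  define S where "S = {t. norm (m + t *\<^sub>R a) < E + t * b}"
  have S: "open S" "0 \<in> S"
    unfolding S_def using \<open>norm m < E\<close> by (auto intro!: open_Collect_less continuous_intros)
  define D where "D t = sqrt (4 * (E + t * b)\<^sup>2 - 3 * (m \<bullet> m + 2 * t * (m \<bullet> a) + t\<^sup>2 * (a \<bullet> a)))" for t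
  define P where "P t = (D t - (E + t * b)) / 3" for t
  have D0: "D 0 = p * (6 + 4 * s)"
  proof -
    have "D 0 = sqrt ((p * (6 + 4 * s))\<^sup>2)"
      unfolding D_def m_def E_def s_def using disc_conserved[of p u] by simp
    then show ?thesis using p s by simp
  qed
  have P0: "P 0 = p" unfolding P_def D0 E by (simp add: algebra_simps)
  have D0pos: "D 0 > 0" unfolding D0 using p s by (simp add: add_pos_nonneg)
  have dD: "(D has_real_derivative (4 * E * b - 3 * (m \<bullet> a)) / D 0) (at 0)"
  proof -
    have "4 * E\<^sup>2 - 3 * (m \<bullet> m) > 0" using D0pos unfolding D_def by simp
    then show ?thesis unfolding D_def
      by (auto intro!: derivative_eq_intros simp: field_simps)
  qed
  define P' where "P' = ((4 * E * b - 3 * (m \<bullet> a)) / D 0 - b) / 3"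
  have dP: "(P has_real_derivative P') (at 0)"
    unfolding P_def[abs_def] P'_def by (auto intro!: derivative_eq_intros dD)
  have PE: "p + E = (2 * sqrt p * g)\<^sup>2" unfolding E using p g by (simp add: power_mult_distrib algebra_simps)
  have sPE: "sqrt (p + E) = 2 * sqrt p * g" unfolding PE using p g by simp
  have p14: "p powr (-3/4) * sqrt p = p powr (-1/4)"
    using p by (simp add: powr_half_sqrt[symmetric] powr_add[symmetric])
  have p14': "p powr (1/4) / sqrt p = p powr (-1/4)"
    using p by (simp add: powr_half_sqrt[symmetric] powr_diff[symmetric])
  have "((\<lambda>t. P t powr (1/4) * sqrt (P t + (E + t * b)) / 2) has_real_derivative
      (1/4 * p powr (-3/4) * P' * sqrt (p + E) + p powr (1/4) * ((P' + b) / (2 * sqrt (p + E)))) / 2) (at 0)"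
    using p E0 by (auto intro!: derivative_eq_intros dP simp: P0 field_simps powr_diff)
  also have "(1/4 * p powr (-3/4) * P' * sqrt (p + E) + p powr (1/4) * ((P' + b) / (2 * sqrt (p + E)))) / 2
     = p powr (-1/4) / 4 * (P' * g + (P' + b) / (2 * g))"
  proof -
    have 1: "p powr (-3/4) * P' * sqrt (p + E) = 2 * p powr (-1/4) * P' * g"
      unfolding sPE p14[symmetric] by simp
    have 2: "p powr (1/4) * ((P' + b) / (2 * sqrt (p + E))) = p powr (-1/4) * (P' + b) / (4 * g)"
      unfolding sPE p14'[symmetric] by simp
    have "(1/4 * p powr (-3/4) * P' * sqrt (p + E) + p powr (1/4) * ((P' + b) / (2 * sqrt (p + E)))) / 2
      = (1/4 * (2 * p powr (-1/4) * P' * g) + p powr (-1/4) * (P' + b) / (4 * g)) / 2"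
      unfolding 1[symmetric] 2[symmetric] by simp
    also have "\<dots> = p powr (-1/4) / 4 * (P' * g + (P' + b) / (2 * g))"
      using g by (simp add: field_simps)
    finally show ?thesis .
  qed
  also have "P' * g + (P' + b) / (2 * g) = b * g - u \<bullet> a"
  proof -
    have ne: "6 + 4 * s > 0" using s by simp
    have P': "P' * (3 * (6 + 4 * s)) = b * (6 + 12 * s) - 12 * g * (u \<bullet> a)"
    proof -
      define q where "q = 6 + 4 * s"
      have q: "q > 0" "s = (q - 6) / 4" using ne by (simp_all add: q_def)
      have "P' * (3 * q) = (4 * E * b - 3 * (m \<bullet> a)) / (p * q) * q - b * q"
        unfolding P'_def D0 q_def[symmetric] by algebra
      also have "\<dots> = (p * (4 * (3 + 4 * s) * b - 12 * g * (u \<bullet> a))) / p - b * q"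
      proof -
        have "X / (p * q) * q = X / p" for X using q(1) by simp
        then show ?thesis unfolding mu E by (simp only: inner_scaleR_left) (simp only: algebra_simps, simp)
      qed
      also have "\<dots> = b * (6 + 12 * s) - 12 * g * (u \<bullet> a)"
        using p by (subst nonzero_mult_div_cancel_left) (simp_all add: q_def algebra_simps)
      finally show ?thesis by (simp add: q_def)
    qed
    have "(P' * g + (P' + b) / (2 * g)) * (2 * g) = P' * (2 * g\<^sup>2 + 1) + b"
    proof -
      have "(P' + b) / (2 * g) * (2 * g) = P' + b" using g(1) by simp
      then show ?thesis by algebra
    qed
    also have "\<dots> = (P' * (3 * (6 + 4 * s))) / 6 + b" unfolding g by (simp add: field_simps)
    also have "\<dots> = (b * g - u \<bullet> a) * (2 * g)"
      unfolding P' using g(2) by algebra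
    finally show ?thesis using g by simp
  qed
  finally have d: "((\<lambda>t. P t powr (1/4) * sqrt (P t + (E + t * b)) / 2) has_real_derivative
     p powr (-1/4) / 4 * (b * g - u \<bullet> a)) (at 0)" .
  have "P t powr (1/4) * sqrt (P t + (E + t * b)) / 2 = entropy_cons (conserved (p, u) + t *\<^sub>R (a, b))"
    if "t \<in> S" for t
  proof -
    have w: "conserved (p, u) + t *\<^sub>R (a, b) = (m + t *\<^sub>R a, E + t * b)"
      by (simp add: m_def E_def prod_eq_iff)
    have "cons_root (m + t *\<^sub>R a, E + t * b) = P t"
      by (simp add: cons_root_def P_def D_def inner_add_left inner_add_right inner_commute
          power2_eq_square algebra_simps)
    with that show ?thesis unfolding w S_def by (subst entropy_cons_eq) simp_all
  qed
  from has_field_derivative_transform_within_open[OF d S this]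
  show ?thesis by (simp add: g_def s_def)
qed

lemma entropy_vars_explicit:
  fixes u :: "real ^ 'd::finite"
  assumes "p > 0"
  shows "entropy_vars (p, u) =
    (\<chi> j. - (1/4) * p powr (-1/4) * u $ j, 1/4 * p powr (-1/4) * sqrt (1 + (norm u)\<^sup>2))"
  unfolding entropy_vars_def DERIV_imp_deriv[OF entropy_cons_deriv[OF assms]]
  by (simp add: vec_eq_iff inner_axis power2_norm_eq_inner)

end

theory Submission
  imports Defs
begin

text \<open>
  Everything becomes polynomial in the rescaled four-velocity \<open>(a, b) = p\<^sup>-\<^sup>1\<^sup>/\<^sup>4 (u, sqrt (1 + |u|\<^sup>2))\<close>,
  because the entropy variables are \<open>(- a, b) / 4\<close> and the flux potential is \<open>- p a\<^sub>k / 4\<close>. Since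
  \<open>(u, sqrt (1 + |u|\<^sup>2))\<close> lies on the unit hyperboloid, \<open>b\<^sup>2 - |a|\<^sup>2 = 1 / sqrt p\<close>: the Minkowski square
  of the entropy variables depends on the pressure alone.

  The part of the numerical flux that comes from the means of \<open>a\<close> and \<open>b\<close> therefore pairs with the
  jump of the entropy variables to a multiple of the jump of \<open>b\<^sup>2 - |a|\<^sup>2\<close>, by
  \<open>jump x * mean x = jump (x\<^sup>2) / 2\<close>. The factor \<open>2 (p\<^sub>- sqrt p\<^sub>+ + p\<^sub>+ sqrt p\<^sub>-)\<close> is exactly the one that
  turns the jump of \<open>1 / sqrt p\<close> into \<open>-2\<close> times the jump of \<open>p\<close> (lemma \<open>coeff_times_jump\<close>). What
  remains is \<open>- (jump p * mean a\<^sub>k + mean p * jump a\<^sub>k) / 4\<close>, which the discrete product rule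
  identifies with the jump of the flux potential. Symmetry holds because means are symmetric;
  consistency holds because \<open>4 p sqrt p p\<^sup>-\<^sup>1\<^sup>/\<^sup>4 p\<^sup>-\<^sup>1\<^sup>/\<^sup>4 = 4 p\<close>.
\<close>

definition scaled_velocity :: "('d::finite) state \<Rightarrow> real ^ 'd" where
  "scaled_velocity s = fst s powr (-1/4) *\<^sub>R snd s"

definition scaled_lorentz :: "('d::finite) state \<Rightarrow> real" where
  "scaled_lorentz s = fst s powr (-1/4) * sqrt (1 + (norm (snd s))\<^sup>2)"

lemma statesD: "s \<in> states \<Longrightarrow> fst s > 0"
  by (auto simp: states_def)

lemma powr_quarter_squared: "(p::real) > 0 \<Longrightarrow> (p powr (-1/4))\<^sup>2 = 1 / sqrt p"
  by (simp add: power2_eq_square powr_add[symmetric] powr_minus_divide powr_half_sqrt)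

lemma entropy_vars_scaled:
  assumes "s \<in> states"
  shows "entropy_vars s = (- (1/4) *\<^sub>R scaled_velocity s, scaled_lorentz s / 4)"
proof -
  obtain p u where "s = (p, u)" by force
  with assms show ?thesis
    by (simp add: states_def entropy_vars_explicit scaled_velocity_def scaled_lorentz_def vec_eq_iff)
qed

text \<open>The hyperboloid relation \<open>(1 + |u|\<^sup>2) - |u|\<^sup>2 = 1\<close>, multiplied by \<open>(p\<^sup>-\<^sup>1\<^sup>/\<^sup>4)\<^sup>2\<close>.\<close>

lemma minkowski_square:
  assumes "s \<in> states"
  shows "(scaled_lorentz s)\<^sup>2 - scaled_velocity s \<bullet> scaled_velocity s = 1 / sqrt (fst s)"
proof -
  have "(scaled_lorentz s)\<^sup>2 = (fst s powr (-1/4))\<^sup>2 * (1 + snd s \<bullet> snd s)"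
    by (simp add: scaled_lorentz_def power_mult_distrib power2_norm_eq_inner)
  moreover have "scaled_velocity s \<bullet> scaled_velocity s = (fst s powr (-1/4))\<^sup>2 * (snd s \<bullet> snd s)"
    by (simp add: scaled_velocity_def power2_eq_square)
  ultimately show ?thesis
    using powr_quarter_squared[OF statesD[OF assms]] by (simp add: algebra_simps)
qed

text \<open>
  In \<open>h \<bullet> F\<^sub>k\<close> the terms with \<open>|u|\<^sup>2\<close> cancel and \<open>3/4\<close> of the entropy flux \<open>p p\<^sup>-\<^sup>1\<^sup>/\<^sup>4 u\<^sub>k\<close> remains.
\<close>

lemma flux_potential_scaled:
  assumes "s \<in> states"
  shows "flux_potential k s = - (fst s * scaled_velocity s $ k) / 4"
proof -
  obtain p u where s: "s = (p, u)" by force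
  have p: "p > 0" using assms by (simp add: s states_def)
  define r where "r = p powr (-1/4)"
  define l where "l = sqrt (1 + u \<bullet> u)"
  have l: "l\<^sup>2 = 1 + u \<bullet> u" by (simp add: l_def)
  have pr: "p powr (3/4) = p * r"
    using p powr_add[of p 1 "-1/4"] by (simp add: r_def)
  have F: "phys_flux k (p, u) = (p *\<^sub>R axis k 1 + (4 * p * u $ k) *\<^sub>R u, 4 * p * u $ k * l)"
    by (simp add: phys_flux_def l_def power2_norm_eq_inner vec_eq_iff axis_def)
  have h: "entropy_vars (p, u) = (- (r / 4) *\<^sub>R u, r * l / 4)"
    using entropy_vars_scaled[OF assms]
    by (simp add: s scaled_velocity_def scaled_lorentz_def r_def l_def power2_norm_eq_inner)
  have "entropy_vars (p, u) \<bullet> phys_flux k (p, u)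
      = - (r / 4) * (p * u $ k + 4 * p * u $ k * (u \<bullet> u)) + p * u $ k * r * l\<^sup>2"
    unfolding F h by (simp add: inner_axis inner_add_right algebra_simps power2_eq_square)
  also have "\<dots> = 3/4 * (p * r * u $ k)"
    unfolding l by (simp add: algebra_simps)
  finally show ?thesis
    by (simp add: s flux_potential_def entropy_flux_def pr scaled_velocity_def r_def)
qed

definition flux_coeff :: "('d::finite) state \<Rightarrow> 'd state \<Rightarrow> real" where
  "flux_coeff sm sp = 2 * (fst sm * sqrt (fst sp) + fst sp * sqrt (fst sm))"

lemma num_flux_scaled:
  "num_flux k sm sp =
    (let v = flux_coeff sm sp * ((scaled_velocity sp $ k + scaled_velocity sm $ k) / 2) in
      ((v / 2) *\<^sub>R (scaled_velocity sp + scaled_velocity sm) + ((fst sp + fst sm) / 2) *\<^sub>R axis k 1,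
       v / 2 * (scaled_lorentz sp + scaled_lorentz sm)))"
  by (simp add: num_flux_def Let_def mean_def flux_coeff_def scaled_velocity_def
      scaled_lorentz_def vec_eq_iff axis_def case_prod_beta field_simps)

lemma num_flux_commute: "num_flux k sm sp = num_flux k sp sm"
  by (simp add: num_flux_scaled flux_coeff_def Let_def add.commute)

lemma num_flux_consistent:
  assumes "s \<in> states"
  shows "num_flux k s s = phys_flux k s"
proof -
  obtain p u where s: "s = (p, u)" by force
  have p: "p > 0" using assms by (simp add: s states_def)
  define r where "r = p powr (-1/4)"
  have c: "r * (r * flux_coeff (p, u) (p, u)) = p * 4"
  proof -
    have "r * (r * flux_coeff (p, u) (p, u)) = r\<^sup>2 * (4 * p * sqrt p)"
      by (simp add: flux_coeff_def power2_eq_square)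
    then show ?thesis using p unfolding r_def powr_quarter_squared[OF p] by simp
  qed
  have "scaled_velocity (p, u) = r *\<^sub>R u" "scaled_lorentz (p, u) = r * sqrt (1 + (norm u)\<^sup>2)"
    by (simp_all add: scaled_velocity_def scaled_lorentz_def r_def)
  then show ?thesis
    using c by (simp add: s num_flux_scaled Let_def phys_flux_def vec_eq_iff axis_def mult_ac)
qed

text \<open>
  With \<open>x = sqrt p\<^sub>-\<close> and \<open>y = sqrt p\<^sub>+\<close> the coefficient is \<open>2 x y (x + y)\<close> and the jump of
  \<open>1 / sqrt p\<close> is \<open>(x - y) / (x y)\<close>.
\<close>

lemma coeff_times_jump:
  assumes "sm \<in> states" "sp \<in> states"
  shows "flux_coeff sm sp * (1 / sqrt (fst sp) - 1 / sqrt (fst sm)) = - 2 * (fst sp - fst sm)"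
proof -
  define x y where "x = sqrt (fst sm)" and "y = sqrt (fst sp)"
  have pos: "x > 0" "y > 0" using assms by (simp_all add: x_def y_def statesD)
  have sq: "fst sm = x\<^sup>2" "fst sp = y\<^sup>2"
    using assms by (simp_all add: x_def y_def statesD less_imp_le)
  have "flux_coeff sm sp = 2 * (x\<^sup>2 * y + y\<^sup>2 * x)"
    by (simp only: flux_coeff_def x_def[symmetric] y_def[symmetric]) (simp only: sq)
  then show ?thesis
    unfolding x_def[symmetric] y_def[symmetric] unfolding sq
    using pos by (simp add: field_simps power2_eq_square)
qed

lemma num_flux_entropy_conservative:
  assumes "sm \<in> states" "sp \<in> states"
  shows "jump entropy_vars sm sp \<bullet> num_flux k sm sp = jump (flux_potential k) sm sp"
proof -
  define am ap where "am = scaled_velocity sm" and "ap = scaled_velocity sp"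
  define bm bp where "bm = scaled_lorentz sm" and "bp = scaled_lorentz sp"
  define pm pp where "pm = fst sm" and "pp = fst sp"
  define v where "v = flux_coeff sm sp * ((ap $ k + am $ k) / 2)"
  have h: "jump entropy_vars sm sp = (- (1/4) *\<^sub>R (ap - am), (bp - bm) / 4)"
    by (simp add: jump_def entropy_vars_scaled assms am_def ap_def bm_def bp_def algebra_simps)
  have F: "num_flux k sm sp
      = ((v / 2) *\<^sub>R (ap + am) + ((pp + pm) / 2) *\<^sub>R axis k 1, v / 2 * (bp + bm))"
    by (simp add: num_flux_scaled Let_def v_def am_def ap_def bm_def bp_def pm_def pp_def)
  have "jump entropy_vars sm sp \<bullet> num_flux k sm sp
      = v / 8 * ((bp\<^sup>2 - ap \<bullet> ap) - (bm\<^sup>2 - am \<bullet> am)) - (pp + pm) / 8 * (ap $ k - am $ k)"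
    unfolding h F
    by (simp add: inner_axis inner_add_right inner_diff_left inner_commute[of am ap]
        power2_eq_square field_simps)
  also have "(bp\<^sup>2 - ap \<bullet> ap) - (bm\<^sup>2 - am \<bullet> am) = 1 / sqrt pp - 1 / sqrt pm"
    using assms by (simp add: ap_def am_def bp_def bm_def pp_def pm_def minkowski_square)
  also have "v / 8 * (1 / sqrt pp - 1 / sqrt pm)
      = (ap $ k + am $ k) / 16 * (flux_coeff sm sp * (1 / sqrt pp - 1 / sqrt pm))"
    by (simp add: v_def)
  also have "\<dots> = - (ap $ k + am $ k) / 8 * (pp - pm)"
    unfolding pp_def pm_def coeff_times_jump[OF assms] by (simp add: field_simps)
  also have "- (ap $ k + am $ k) / 8 * (pp - pm) - (pp + pm) / 8 * (ap $ k - am $ k)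
      = - (pp * ap $ k) / 4 + pm * am $ k / 4"
    by (simp add: field_simps)
  also have "\<dots> = jump (flux_potential k) sm sp"
    by (simp add: jump_def flux_potential_scaled assms ap_def am_def pp_def pm_def)
  finally show ?thesis .
qed

theorem theorem3p1:
  assumes dim: "CARD('d::finite) \<in> {2, 3}"
  shows "\<forall>k::'d.
      (\<forall>sm\<in>states. \<forall>sp\<in>states. num_flux k sm sp = num_flux k sp sm)
    \<and> (\<forall>s\<in>states. num_flux k s s = phys_flux k s)
    \<and> (\<forall>sm\<in>states. \<forall>sp\<in>states.
         jump entropy_vars sm sp \<bullet> num_flux k sm sp - jump (flux_potential k) sm sp = 0)"
  using num_flux_commute num_flux_consistent num_flux_entropy_conservative by (metis diff_self)

end
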